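(* Let the sequences $\{\gamma_k\}_{k\ge0}$, $\{\delta_k\}_{k\ge0}$, $\{\mu_k\}_{k\ge0}$ be given by $$\gamma_k=\frac{\gamma_0}{(k+1)^a},\qquad \delta_k=\frac{\delta_0}{(k+1)^b},\qquad \mu_k=\frac{\mu_0 2^c}{(k+\kappa)^c},$$ where $\kappa=2$ if $k$ is even and $\kappa=1$ otherwise, $\gamma_0,\delta_0,\mu_0$ are positive scalars such that $\delta_0\mu_0\le 2^b$ and $\gamma_0\delta_0\mu_0\le 1$, and $a,b,c$ are positive scalars satisfying $$a>3c+b,\quad a+b+c\le 1,\quad a-c>0.5,\quad a+2c+b>1.$$ Then the sequences are non-negative and satisfy all of the following conditions: (a) $\lim_{k\to\infty}\frac{\gamma_k}{\mu_k^3\delta_k}=0$; (b) $\delta_k\mu_{k-1}\le 1$ for $k\ge 1$; (c) $\mu_{k+1}=\mu_k$ if $k$ is even, $\mu_{k+1}<\mu_k$ if $k$ is odd, and $\mu_k\to 0$; (d) $\sum_{k=0}^\infty\gamma_k\delta_k\mu_k=\infty$; (e) $\sum_{k=0}^\infty\left(\frac{\gamma_k}{\mu_k}\right)^2<\infty$; (f) $\sum_{k=0}^\infty\gamma_k\delta_k\mu_k^2<\infty$; (g) $\gamma_k\delta_k\mu_k\le 1$ for $k\ge 0$.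
   Context: All sequences are real and indexed by integers $k\ge 0$; $\kappa$ depends on the parity of the index $k$. *)

theory Defs
  imports Complex_Main
begin

end

theory Submission
  imports Defs "HOL-Analysis.Summation_Tests"
begin

text \<open>For every k the denominator k + \<kappa>(k) lies between k + 1 and 2(k + 1), so \<mu>(k) lies between
  two constant multiples of (k + 1) to the power -c. All sums and limits are thereby reduced to those
  of a pure power of k + 1, whose exponent is controlled by the assumptions on a, b, c.\<close>

text \<open>Shifting the index by one does not affect convergence, so the p-series criterion carries
  over. It settles the divergence in (d) and the convergence in (e) and (f), where only the exponent
  has to be compared with -1.\<close>

lemma summable_Suc_powr_iff: "summable (\<lambda>k. (real k + 1) powr s) \<longleftrightarrow> s < -1"
proof -
  have "summable (\<lambda>k. real (Suc k) powr s) \<longleftrightarrow> summable (\<lambda>k. real k powr s)"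
    by (rule summable_Suc_iff)
  then show ?thesis
    by (simp add: summable_real_powr_iff add.commute)
qed

text \<open>Partial sums of non-negative terms increase. If one bound Z held for all of them, the
  series would converge; so each Z is exceeded once, and from then on always. This turns failure of
  summability into the divergence to infinity asked for in (d).\<close>

lemma filterlim_sum_at_top_if_not_summable:
  fixes f :: "nat \<Rightarrow> real"
  assumes nonneg: "\<And>k. f k \<ge> 0" and "\<not> summable f"
  shows "filterlim (\<lambda>n. \<Sum>k\<le>n. f k) at_top sequentially"
  unfolding filterlim_at_top
proof
  fix Z
  have "\<exists>n. Z < (\<Sum>k<n. f k)"
  proof (rule ccontr)
    assume "\<nexists>n. Z < (\<Sum>k<n. f k)"
    then have "summable f"
      by (intro summableI_nonneg_bounded[where x = Z]) (auto simp: nonneg not_less)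
    with assms(2) show False ..
  qed
  then obtain n where n: "Z < (\<Sum>k<n. f k)" ..
  show "\<forall>\<^sub>F m in sequentially. Z \<le> (\<Sum>k\<le>m. f k)"
    using eventually_ge_at_top[of n]
  proof eventually_elim
    case (elim m)
    then have "(\<Sum>k<n. f k) \<le> (\<Sum>k\<le>m. f k)"
      by (intro sum_mono2) (auto simp: nonneg)
    with n show ?case by simp
  qed
qed

theorem lemma4:
  fixes \<gamma> \<delta> \<mu> \<kappa> :: "nat \<Rightarrow> real"
    and \<gamma>\<^sub>0 \<delta>\<^sub>0 \<mu>\<^sub>0 a b c :: real
  assumes kappa: "\<And>k. \<kappa> k = (if even k then 2 else 1)"
    and gamma: "\<And>k. \<gamma> k = \<gamma>\<^sub>0 / (real k + 1) powr a"
    and delta: "\<And>k. \<delta> k = \<delta>\<^sub>0 / (real k + 1) powr b"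
    and mu: "\<And>k. \<mu> k = \<mu>\<^sub>0 * 2 powr c / (real k + \<kappa> k) powr c"
    and init_pos: "\<gamma>\<^sub>0 > 0" "\<delta>\<^sub>0 > 0" "\<mu>\<^sub>0 > 0"
    and init_bounds: "\<delta>\<^sub>0 * \<mu>\<^sub>0 \<le> 2 powr b" "\<gamma>\<^sub>0 * \<delta>\<^sub>0 * \<mu>\<^sub>0 \<le> 1"
    and exp_pos: "a > 0" "b > 0" "c > 0"
    and exp_bounds: "a > 3 * c + b" "a + b + c \<le> 1" "a - c > 1 / 2" "a + 2 * c + b > 1"
  shows "(\<forall>k. \<gamma> k \<ge> 0 \<and> \<delta> k \<ge> 0 \<and> \<mu> k \<ge> 0)
    \<and> (\<lambda>k. \<gamma> k / (\<mu> k ^ 3 * \<delta> k)) \<longlonglongrightarrow> 0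
    \<and> (\<forall>k\<ge>1. \<delta> k * \<mu> (k - 1) \<le> 1)
    \<and> ((\<forall>k. even k \<longrightarrow> \<mu> (k + 1) = \<mu> k) \<and> (\<forall>k. odd k \<longrightarrow> \<mu> (k + 1) < \<mu> k) \<and> \<mu> \<longlonglongrightarrow> 0)
    \<and> filterlim (\<lambda>n. \<Sum>k\<le>n. \<gamma> k * \<delta> k * \<mu> k) at_top sequentially
    \<and> summable (\<lambda>k. (\<gamma> k / \<mu> k)\<^sup>2)
    \<and> summable (\<lambda>k. \<gamma> k * \<delta> k * (\<mu> k)\<^sup>2)
    \<and> (\<forall>k. \<gamma> k * \<delta> k * \<mu> k \<le> 1)"
proof -
  define N where "N = (\<lambda>k::nat. real k + 1)"
  define L where "L = \<mu>\<^sub>0 * 2 powr c"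
  have N_pos: "N k > 0" for k by (simp add: N_def)
  have \<gamma>_eq: "\<gamma> k = \<gamma>\<^sub>0 * N k powr -a" for k
    by (simp add: gamma N_def powr_minus divide_simps)
  have \<delta>_eq: "\<delta> k = \<delta>\<^sub>0 * N k powr -b" for k
    by (simp add: delta N_def powr_minus divide_simps)
  have L_pos: "L > 0" using init_pos by (simp add: L_def)
  \<comment> \<open>Parity matters here: the index 0 is even and gets the shift 2, while an odd
    index is at least 1 and gets the shift 1.\<close>
  have den_ge: "real k + \<kappa> k \<ge> 2" for k
    by (cases "k = 0") (auto simp: kappa)
  have pos: "\<gamma> k > 0" "\<delta> k > 0" "\<mu> k > 0" for k
    using init_pos den_ge[of k] by (auto simp: gamma delta mu intro!: divide_pos_pos mult_pos_pos)
  have \<mu>_upper: "\<mu> k \<le> L * N k powr -c" for k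
  proof -
    have "N k powr c \<le> (real k + \<kappa> k) powr c"
      using exp_pos by (intro powr_mono2) (auto simp: N_def kappa)
    then have "\<mu> k \<le> L / N k powr c"
      unfolding mu L_def using init_pos N_pos[of k] den_ge[of k] by (intro divide_left_mono) auto
    then show ?thesis by (simp add: powr_minus divide_simps)
  qed
  \<comment> \<open>Since k + 2 is at most 2(k + 1), the factor \<open>2 powr c\<close> in the
    numerator cancels exactly and the constant left is \<open>\<mu>\<^sub>0\<close>.\<close>
  have \<mu>_lower: "\<mu>\<^sub>0 * N k powr -c \<le> \<mu> k" for k
  proof -
    have "(real k + \<kappa> k) powr c \<le> (2 * N k) powr c"
      using exp_pos by (intro powr_mono2) (auto simp: N_def kappa)
    also have "\<dots> = 2 powr c * N k powr c"
      using N_pos[of k] by (simp add: powr_mult)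
    finally have "\<mu>\<^sub>0 * 2 powr c / (2 powr c * N k powr c) \<le> \<mu> k"
      unfolding mu using init_pos N_pos[of k] den_ge[of k]
      by (intro divide_left_mono) auto
    then show ?thesis by (simp add: powr_minus divide_simps)
  qed
  \<comment> \<open>\<open>\<mu>_upper\<close> would only give the larger constant \<open>L\<close>;
    (b) and (g) need \<open>\<mu>\<^sub>0\<close> itself, because \<open>init_bounds\<close> is
    stated with it.\<close>
  have \<mu>_le_init: "\<mu> k \<le> \<mu>\<^sub>0" for k
  proof -
    have "2 powr c \<le> (real k + \<kappa> k) powr c"
      using exp_pos den_ge[of k] by (intro powr_mono2) auto
    then show ?thesis
      using init_pos den_ge[of k] by (simp add: mu divide_simps mult_left_mono)
  qed
  have N_tendsto: "(\<lambda>k. N k powr s) \<longlonglongrightarrow> 0" if "s < 0" for s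
    unfolding N_def using that
    by (intro tendsto_neg_powr filterlim_at_top_mono[OF filterlim_real_sequentially]) auto
  have powr3: "(N k powr s) ^ 3 = N k powr (3 * s)" for k s
    using N_pos[of k] by (simp add: powr_power mult.commute)
  have powr2: "(N k powr s)\<^sup>2 = N k powr (2 * s)" for k s
    using N_pos[of k] by (simp add: powr_power mult.commute)

  have A: "(\<lambda>k. \<gamma> k / (\<mu> k ^ 3 * \<delta> k)) \<longlonglongrightarrow> 0"
  proof (rule tendsto_sandwich)
    define C where "C = \<gamma>\<^sub>0 / (\<mu>\<^sub>0 ^ 3 * \<delta>\<^sub>0)"
    show "\<forall>\<^sub>F k in sequentially. 0 \<le> \<gamma> k / (\<mu> k ^ 3 * \<delta> k)"
      using pos by (simp add: less_imp_le)
    \<comment> \<open>As \<mu> stands in the denominator, its lower bound is the one to use. The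
      resulting exponent is negative because a > 3c + b.\<close>
    have "\<gamma> k / (\<mu> k ^ 3 * \<delta> k) \<le> C * N k powr (3 * c + b - a)" for k
    proof -
      have "\<gamma> k / (\<mu> k ^ 3 * \<delta> k) \<le> \<gamma> k / ((\<mu>\<^sub>0 * N k powr -c) ^ 3 * \<delta> k)"
        using pos[of k] \<mu>_lower[of k] init_pos N_pos[of k]
        by (intro divide_left_mono mult_right_mono power_mono mult_pos_pos zero_less_power) auto
      also have "\<dots> = C * (N k powr -a / (N k powr (3 * -c) * N k powr -b))"
        by (simp add: \<gamma>_eq \<delta>_eq C_def power_mult_distrib powr3)
      also have "N k powr -a / (N k powr (3 * -c) * N k powr -b) = N k powr (3 * c + b - a)"
        by (simp add: algebra_simps flip: powr_add powr_diff)
      finally show ?thesis .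
    qed
    then show "\<forall>\<^sub>F k in sequentially. \<gamma> k / (\<mu> k ^ 3 * \<delta> k) \<le> C * N k powr (3 * c + b - a)"
      by simp
    show "(\<lambda>k. C * N k powr (3 * c + b - a)) \<longlonglongrightarrow> 0"
      using exp_bounds by (intro tendsto_mult_right_zero N_tendsto) simp
  qed simp

  have B: "\<delta> k * \<mu> (k - 1) \<le> 1" if "k \<ge> 1" for k
  proof -
    \<comment> \<open>From k = 1 on, k + 1 is at least 2, so \<open>\<delta> k\<close> gains a
      factor \<open>2 powr -b\<close>. This absorbs the slack in the hypothesis on
      \<open>\<delta>\<^sub>0 * \<mu>\<^sub>0\<close>.\<close>
    have "2 powr b \<le> N k powr b"
      using exp_pos that by (intro powr_mono2) (auto simp: N_def)
    then have "\<delta> k \<le> \<delta>\<^sub>0 / 2 powr b"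
      unfolding delta N_def using init_pos by (intro divide_left_mono) auto
    then have "\<delta> k * \<mu> (k - 1) \<le> \<delta>\<^sub>0 / 2 powr b * \<mu>\<^sub>0"
      using pos[of "k - 1"] \<mu>_le_init[of "k - 1"] init_pos by (intro mult_mono) auto
    also have "\<dots> \<le> 1"
      using init_bounds by simp
    finally show ?thesis .
  qed

  \<comment> \<open>Both denominators have base k + 2, once as k + 2 and once as (k + 1) +
    1.\<close>
  have C1: "\<mu> (k + 1) = \<mu> k" if "even k" for k
    using that by (simp add: mu kappa add.commute)
  \<comment> \<open>Passing from odd k to the even index k + 1 raises the shift as well, so the base
    jumps from k + 1 to k + 3.\<close>
  have C2: "\<mu> (k + 1) < \<mu> k" if "odd k" for k
  proof -
    have "(real k + 1) powr c < (real k + 3) powr c"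
      using exp_pos by (intro powr_less_mono2) auto
    then show ?thesis
      using that init_pos by (simp add: mu kappa add.commute divide_strict_left_mono)
  qed
  have C3: "\<mu> \<longlonglongrightarrow> 0"
  proof (rule tendsto_sandwich[OF _ _ tendsto_const])
    show "(\<lambda>k. L * N k powr -c) \<longlonglongrightarrow> 0"
      using exp_pos by (intro tendsto_mult_right_zero N_tendsto) simp
  qed (use pos \<mu>_upper in \<open>auto simp: less_imp_le\<close>)

  have D: "filterlim (\<lambda>n. \<Sum>k\<le>n. \<gamma> k * \<delta> k * \<mu> k) at_top sequentially"
  proof (rule filterlim_sum_at_top_if_not_summable)
    show "\<gamma> k * \<delta> k * \<mu> k \<ge> 0" for k
      using pos[of k] by simp
    define K where "K = \<gamma>\<^sub>0 * \<delta>\<^sub>0 * \<mu>\<^sub>0"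
    have "K > 0" using init_pos by (simp add: K_def)
    have powr_sum: "N k powr -(a + b + c) = N k powr -a * N k powr -b * N k powr -c" for k
      by (simp add: algebra_simps flip: powr_add)
    \<comment> \<open>Divergence needs a minorant, hence the lower bound on \<mu>. Its exponent is
      at least -1 because a + b + c is at most 1; equality is the harmonic series.\<close>
    have "K * N k powr -(a + b + c) \<le> \<gamma> k * \<delta> k * \<mu> k" for k
    proof -
      have "K * N k powr -(a + b + c) = \<gamma> k * \<delta> k * (\<mu>\<^sub>0 * N k powr -c)"
        by (simp add: K_def \<gamma>_eq \<delta>_eq powr_sum del: minus_add_distrib)
      also have "\<dots> \<le> \<gamma> k * \<delta> k * \<mu> k"
        using pos[of k] \<mu>_lower[of k] by (intro mult_left_mono) auto
      finally show ?thesis .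
    qed
    moreover have "\<not> summable (\<lambda>k. K * N k powr -(a + b + c))"
      using \<open>K > 0\<close> exp_bounds unfolding N_def by (simp add: summable_cmult_iff summable_Suc_powr_iff)
    ultimately show "\<not> summable (\<lambda>k. \<gamma> k * \<delta> k * \<mu> k)"
      using summable_comparison_test'[of "\<lambda>k. \<gamma> k * \<delta> k * \<mu> k" 0 "\<lambda>k. K * N k powr -(a + b + c)"]
        \<open>K > 0\<close> by auto
  qed

  have E: "summable (\<lambda>k. (\<gamma> k / \<mu> k)\<^sup>2)"
  proof (rule summable_comparison_test')
    \<comment> \<open>The condition 2(c - a) < -1 is the assumption a - c > 1/2.\<close>
    show "summable (\<lambda>k. (\<gamma>\<^sub>0 / \<mu>\<^sub>0)\<^sup>2 * N k powr (2 * (c - a)))"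
      unfolding N_def using exp_bounds by (intro summable_mult) (simp add: summable_Suc_powr_iff)
    show "norm ((\<gamma> k / \<mu> k)\<^sup>2) \<le> (\<gamma>\<^sub>0 / \<mu>\<^sub>0)\<^sup>2 * N k powr (2 * (c - a))" for k
    proof -
      have "\<gamma> k / \<mu> k \<le> \<gamma> k / (\<mu>\<^sub>0 * N k powr -c)"
        using pos[of k] \<mu>_lower[of k] init_pos N_pos[of k] by (intro divide_left_mono) auto
      also have "\<dots> = \<gamma>\<^sub>0 / \<mu>\<^sub>0 * (N k powr -a / N k powr -c)"
        by (simp add: \<gamma>_eq)
      also have "N k powr -a / N k powr -c = N k powr (c - a)"
        by (simp add: algebra_simps flip: powr_diff)
      finally have "(\<gamma> k / \<mu> k)\<^sup>2 \<le> (\<gamma>\<^sub>0 / \<mu>\<^sub>0 * N k powr (c - a))\<^sup>2"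
        using pos[of k] by (intro power_mono) auto
      then show ?thesis
        unfolding power_mult_distrib powr2 by simp
    qed
  qed

  have F: "summable (\<lambda>k. \<gamma> k * \<delta> k * (\<mu> k)\<^sup>2)"
  proof (rule summable_comparison_test')
    show "summable (\<lambda>k. \<gamma>\<^sub>0 * \<delta>\<^sub>0 * L\<^sup>2 * N k powr -(a + 2 * c + b))"
      unfolding N_def using exp_bounds by (intro summable_mult) (simp add: summable_Suc_powr_iff)
    show "norm (\<gamma> k * \<delta> k * (\<mu> k)\<^sup>2) \<le> \<gamma>\<^sub>0 * \<delta>\<^sub>0 * L\<^sup>2 * N k powr -(a + 2 * c + b)" for k
    proof -
      have "norm (\<gamma> k * \<delta> k * (\<mu> k)\<^sup>2) = \<gamma> k * \<delta> k * (\<mu> k)\<^sup>2"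
        using pos[of k] by simp
      \<comment> \<open>The second factor \<mu>, compared with (d), lowers the exponent by a further
        c, which carries it below -1.\<close>
      also have "\<dots> \<le> \<gamma> k * \<delta> k * (L * N k powr -c)\<^sup>2"
        using pos[of k] \<mu>_upper[of k] by (intro mult_left_mono power_mono) auto
      also have "\<dots> = \<gamma>\<^sub>0 * \<delta>\<^sub>0 * L\<^sup>2 * (N k powr -a * N k powr (2 * -c) * N k powr -b)"
        by (simp add: \<gamma>_eq \<delta>_eq power_mult_distrib powr2)
      also have "N k powr -a * N k powr (2 * -c) * N k powr -b = N k powr -(a + 2 * c + b)"
        by (simp add: algebra_simps flip: powr_add)
      finally show ?thesis .
    qed
  qed

  have G: "\<gamma> k * \<delta> k * \<mu> k \<le> 1" for k
  proof -
    \<comment> \<open>Each of the three factors is largest at index 0, where the product is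
      \<open>\<gamma>\<^sub>0 * \<delta>\<^sub>0 * \<mu>\<^sub>0\<close>.\<close>
    have "\<gamma> k \<le> \<gamma>\<^sub>0" "\<delta> k \<le> \<delta>\<^sub>0"
      using init_pos exp_pos by (simp_all add: gamma delta divide_simps ge_one_powr_ge_zero)
    then have "\<gamma> k * \<delta> k * \<mu> k \<le> \<gamma>\<^sub>0 * \<delta>\<^sub>0 * \<mu>\<^sub>0"
      using pos[of k] init_pos \<mu>_le_init[of k] by (intro mult_mono) auto
    with init_bounds show ?thesis by simp
  qed

  show ?thesis
    using pos A B C1 C2 C3 D E F G by (auto simp: less_imp_le)
qed

end
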